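(* Let $\mathfrak a,\mathfrak b$ be two formal Laurent series satisfying property ( * ), with $\mathfrak a\,\underline{\otimes}\,\mathfrak b\ne0$. If $d_{\mathfrak a}=0$, then for all $n\in\mathbb Z$ $$h_n(\mathfrak a\,\underline{\otimes}\,\mathfrak b)=a_nb_n=h_n(\mathfrak a)\sum_{j=\sigma_{\mathfrak b}}^{n}h_j(\mathfrak b)\binom{b_{\mathfrak b}+n-j}{n-j}.$$ Moreover, $\deg h(\mathfrak a\,\underline{\otimes}\,\mathfrak b)(t)\le\deg\mathfrak a$. If in addition $d_{\mathfrak b}>0$ and $h_j(\mathfrak b)\ge0$ (real and nonnegative) for all $j$, then $\deg h(\mathfrak a\,\underline{\otimes}\,\mathfrak b)(t)=\deg\mathfrak a$.
   Context: A formal Laurent series $\mathfrak a=\sum_{l\ge\sigma_{\mathfrak a}}a_lt^l$ ($\sigma_{\mathfrak a}\in\mathbb Z$, $a_l\in\mathbb C$) satisfies property ( * ) if $\mathfrak a=\dfrac{h(\mathfrak a)(t)}{(1-t)^{d_{\mathfrak a}}}$ for some integer $d_{\mathfrak a}\ge 0$ and some $h(\mathfrak a)(t)\in\mathbb C[t,t^{-1}]$. Equivalently, there is a polynomial $\Phi_{\mathfrak a}$ with $a_l=\Phi_{\mathfrak a}(l)$ for $l\gg0$; one takes $d_{\mathfrak a}=\deg\Phi_{\mathfrak a}+1$ if $\Phi_{\mathfrak a}\ne0$ and $d_{\mathfrak a}=0$ if $\Phi_{\mathfrak a}=0$. Write $h(\mathfrak a)(t)=\sum_n h_n(\mathfrak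 a)t^n$ with $h_n(\mathfrak a)=0$ outside the support, let $\sigma_{\mathfrak a}$ be the least $n$ with $h_n(\mathfrak a)\ne0$ (equivalently $a_n\ne 0$), set $a_l=0$ for $l<\sigma_{\mathfrak a}$, and $b_{\mathfrak a}=d_{\mathfrak a}-1$. The same notation is used for $\mathfrak b=\sum_l b_lt^l$. If $d_{\mathfrak a}=0$ then $\mathfrak a=h(\mathfrak a)(t)$ is a Laurent polynomial, and $\deg\mathfrak a$ is its degree (largest exponent with nonzero coefficient). The Segre transform is $\mathfrak a\,\underline{\otimes}\,\mathfrak b=\sum_{l}a_lb_lt^l$. It again satisfies ( * ), and $d_{\mathfrak a\underline{\otimes}\mathfrak b}=0$ when $d_{\mathfrak a}=0$, so in that case $h(\mathfrak a\underline{\otimes}\mathfrak b)(t)=\mathfrak a\underline{\otimes}\mathfrak b$. Binomial coefficients: for an integer $k\ge0$ and any $m\in\mathbb Z$, $\binom{m}{k}=\frac{m(m-1)\cdots(m-k+1)}{k!}$ (with $\binom m0=1$). Empty sums are $0$. *)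

theory Defs
  imports
    "HOL-Computational_Algebra.Computational_Algebra"
    "HOL-Library.Nonpos_Ints"
begin

unbundle fps_syntax

definition laurent_polynomial :: "complex fls \<Rightarrow> bool" where
  "laurent_polynomial f \<longleftrightarrow> finite {n. f $$ n \<noteq> 0}"

text \<open>The largest exponent occurring in \<open>f\<close>; only meaningful for nonzero Laurent polynomials.\<close>

definition laurent_degree :: "complex fls \<Rightarrow> int" where
  "laurent_degree f = Max {n. f $$ n \<noteq> 0}"

definition property_star :: "complex fls \<Rightarrow> bool" where
  "property_star a \<longleftrightarrow> (\<exists>(d::nat) h. laurent_polynomial h \<and> a = h / (1 - fls_X) ^ d)"

definition eventual_polynomial :: "complex fls \<Rightarrow> complex poly \<Rightarrow> bool" where
  "eventual_polynomial a p \<longleftrightarrow> (\<forall>\<^sub>F l in at_top. a $$ l = poly p (of_int l))"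

text \<open>
  For a series with \<^const>\<open>property_star\<close> the polynomial below exists and is unique
  (\<open>property_star_imp_eventual_polynomial\<close>, \<open>eventual_polynomial_unique\<close>).
\<close>

definition Phi :: "complex fls \<Rightarrow> complex poly" where
  "Phi a = (THE p. eventual_polynomial a p)"

definition d_of :: "complex fls \<Rightarrow> nat" where
  "d_of a = (if Phi a = 0 then 0 else degree (Phi a) + 1)"

definition b_of :: "complex fls \<Rightarrow> int" where
  "b_of a = int (d_of a) - 1"

text \<open>The numerator of \<open>a\<close> over \<open>(1 - t)\<close> to the power \<open>d_of a\<close>; see \<open>property_star_numerator\<close>.\<close>

definition h_of :: "complex fls \<Rightarrow> complex fls" where
  "h_of a = a * (1 - fls_X) ^ d_of a"

text \<open>The least exponent of the numerator, and equally of the series itself (\<open>sigma_of_eq\<close>).\<close>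

definition sigma_of :: "complex fls \<Rightarrow> int" where
  "sigma_of a = fls_subdegree (h_of a)"

definition segre :: "complex fls \<Rightarrow> complex fls \<Rightarrow> complex fls" where
  "segre a b = Abs_fls (\<lambda>n. a $$ n * b $$ n)"

lemma segre_nth [simp]: "segre a b $$ n = a $$ n * b $$ n"
  unfolding segre_def
  by (rule nth_Abs_fls_lower_bound[of "fls_subdegree a"]) simp

lemma one_minus_fls_X_neq_0: "(1 - fls_X :: complex fls) \<noteq> 0"
proof
  assume "(1 - fls_X :: complex fls) = 0"
  then have "(1 - fls_X :: complex fls) $$ 0 = 0" by simp
  then show False by simp
qed

lemma h_of_eq: "a = h_of a / (1 - fls_X) ^ d_of a"
  unfolding h_of_def using one_minus_fls_X_neq_0 by simp

lemma sigma_of_eq: "sigma_of a = fls_subdegree a"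
proof (cases "a = 0")
  case False
  have "fls_subdegree (1 - fls_X :: complex fls) = 0"
    by (rule fls_subdegree_eqI) auto
  with False show ?thesis
    unfolding sigma_of_def h_of_def
    using one_minus_fls_X_neq_0 by (simp add: fls_subdegree_pow)
qed (simp add: sigma_of_def h_of_def)

lemma laurent_polynomial_iff:
  "laurent_polynomial f \<longleftrightarrow> (\<forall>\<^sub>F l in at_top. f $$ l = 0)"
proof
  assume "laurent_polynomial f"
  then have "bdd_above {n. f $$ n \<noteq> 0}"
    by (simp add: laurent_polynomial_def)
  then obtain M where "\<And>n. f $$ n \<noteq> 0 \<Longrightarrow> n \<le> M"
    by (auto simp: bdd_above_def)
  then have "\<forall>l \<ge> M + 1. f $$ l = 0" by force
  then show "\<forall>\<^sub>F l in at_top. f $$ l = 0"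
    by (auto simp: eventually_at_top_linorder)
next
  assume "\<forall>\<^sub>F l in at_top. f $$ l = 0"
  then obtain N where N: "\<And>l. l \<ge> N \<Longrightarrow> f $$ l = 0"
    by (auto simp: eventually_at_top_linorder)
  have "{n. f $$ n \<noteq> 0} \<subseteq> {fls_subdegree f..N}"
  proof (intro subsetI)
    fix n assume "n \<in> {n. f $$ n \<noteq> 0}"
    then have "f $$ n \<noteq> 0" by simp
    then show "n \<in> {fls_subdegree f..N}"
      using N[of n] fls_subdegree_leI[of f n] by (cases "n \<ge> N") auto
  qed
  then show "laurent_polynomial f"
    unfolding laurent_polynomial_def by (rule finite_subset) simp
qed

lemma eventual_polynomial_0_iff: "eventual_polynomial f 0 \<longleftrightarrow> laurent_polynomial f"
  by (simp add: eventual_polynomial_def laurent_polynomial_iff)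

lemma eventual_polynomial_unique:
  assumes "eventual_polynomial a p" "eventual_polynomial a q"
  shows "p = q"
proof (rule ccontr)
  assume "p \<noteq> q"
  then have fin: "finite {x. poly (p - q) x = 0}"
    by (intro poly_roots_finite) simp
  have "\<forall>\<^sub>F l::int in at_top. poly (p - q) (of_int l) = 0"
    using assms unfolding eventual_polynomial_def
    by eventually_elim simp
  then obtain N :: int where N: "\<And>l. l \<ge> N \<Longrightarrow> poly (p - q) (of_int l) = 0"
    by (auto simp: eventually_at_top_linorder)
  have "of_int ` {N..} \<subseteq> {x. poly (p - q) x = 0}"
    using N by auto
  with fin have "finite ((of_int :: int \<Rightarrow> complex) ` {N..})"
    by (rule rev_finite_subset)
  then have "finite {N..}"
    by (rule finite_imageD) (simp add: inj_on_def)
  then show False by (simp add: infinite_Ici)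
qed

lemma Phi_eqI: "eventual_polynomial a p \<Longrightarrow> Phi a = p"
  unfolding Phi_def by (blast intro: the_equality eventual_polynomial_unique)

lemma eventual_polynomial_0: "eventual_polynomial 0 0"
  by (simp add: eventual_polynomial_def)

lemma eventual_polynomial_add:
  assumes "eventual_polynomial f p" "eventual_polynomial g q"
  shows "eventual_polynomial (f + g) (p + q)"
  using assms unfolding eventual_polynomial_def by eventually_elim simp

lemma eventual_polynomial_const_mult:
  assumes "eventual_polynomial f p"
  shows "eventual_polynomial (fls_const c * f) (smult c p)"
  using assms unfolding eventual_polynomial_def by eventually_elim simp

lemma eventual_polynomial_shift:
  assumes "eventual_polynomial f p"
  shows "eventual_polynomial (fls_shift m f) (pcompose p [:of_int m, 1:])"
proof -
  obtain N where N: "\<And>l. l \<ge> N \<Longrightarrow> f $$ l = poly p (of_int l)"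
    using assms by (auto simp: eventual_polynomial_def eventually_at_top_linorder)
  have "\<forall>l \<ge> N - m. fls_shift m f $$ l = poly (pcompose p [:of_int m, 1:]) (of_int l)"
    using N by (auto simp: poly_pcompose add.commute)
  then show ?thesis
    unfolding eventual_polynomial_def eventually_at_top_linorder by blast
qed

lemma eventual_polynomial_sum:
  assumes "finite J" "\<And>j. j \<in> J \<Longrightarrow> \<exists>p. eventual_polynomial (F j) p"
  shows "\<exists>p. eventual_polynomial (\<Sum>j\<in>J. F j) p"
  using assms
proof (induction J rule: finite_induct)
  case empty
  then show ?case using eventual_polynomial_0 by auto
next
  case (insert x J)
  then obtain p q where "eventual_polynomial (F x) p" "eventual_polynomial (\<Sum>j\<in>J. F j) q"
    by (meson insertI1 insertI2)
  with insert show ?case by (auto intro: eventual_polynomial_add)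
qed

lemma inverse_one_minus_fls_X_power:
  "inverse ((1 - fls_X :: complex fls) ^ Suc k)
     = fps_to_fls (Abs_fps (\<lambda>n. of_nat ((n + k) choose k)))"
proof -
  have *: "(1 - fls_X :: complex fls) ^ Suc k = fps_to_fls ((1 - fps_X) ^ Suc k)"
    by (simp only: fps_to_fls_power fps_to_fls_minus fps_X_to_fls fps_one_to_fls)
  have sd: "subdegree ((1 - fps_X :: complex fps) ^ Suc k) = 0"
    by (intro subdegree_eq_0) (simp add: fps_nth_power_0 del: power_Suc)
  have "inverse ((1 - fps_X :: complex fps) ^ Suc k) =
      Abs_fps (\<lambda>n. of_nat ((Suc k + n - 1) choose n))"
    using one_minus_const_fps_X_neg_power'[of "Suc k" "1::complex"] by simp
  also have "\<dots> = Abs_fps (\<lambda>n. of_nat ((n + k) choose k))"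
  proof -
    have "(Suc k + n - 1) choose n = (n + k) choose k" for n
      using binomial_symmetric[of k "n + k"] by (simp add: add.commute)
    then show ?thesis by (simp only:)
  qed
  finally show ?thesis
    unfolding * fls_inverse_fps_to_fls[OF sd] by simp
qed

lemma ex_eventual_polynomial_inverse:
  "\<exists>p. eventual_polynomial (inverse ((1 - fls_X) ^ d)) p"
proof (cases d)
  case 0
  have "laurent_polynomial 1" 
    by (simp add: laurent_polynomial_iff eventually_at_top_linorder) (meson not_one_le_zero)
  with 0 show ?thesis
    by (auto simp: eventual_polynomial_0_iff intro!: exI[of _ 0])
next
  case (Suc k)
  define p :: "complex poly" where
    "p = smult (1 / fact k) (\<Prod>i<k. [:of_nat k - of_nat i, 1:])"
  have "inverse ((1 - fls_X) ^ d) $$ l = poly p (of_int l)" if "l \<ge> 0" for l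
  proof -
    have "inverse ((1 - fls_X) ^ d) $$ l = (of_nat ((nat l + k) choose k) :: complex)"
      using that unfolding Suc inverse_one_minus_fls_X_power by simp
    also have "\<dots> = (of_nat (nat l + k)) gchoose k"
      by (simp add: binomial_gbinomial)
    also have "\<dots> = poly p (of_int l)"
      using that
      by (simp add: p_def gbinomial_prod_rev poly_prod lessThan_atLeast0 algebra_simps)
    finally show ?thesis .
  qed
  then show ?thesis
    unfolding eventual_polynomial_def eventually_at_top_linorder by blast
qed

lemma laurent_polynomial_conv_sum:
  assumes "laurent_polynomial h"
  shows "h = (\<Sum>j | h $$ j \<noteq> 0. fls_const (h $$ j) * fls_X_intpow j)"
proof (rule fls_eqI)
  fix n
  have fin: "finite {j. h $$ j \<noteq> 0}"
    using assms by (simp add: laurent_polynomial_def)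
  have "(\<Sum>j | h $$ j \<noteq> 0. fls_const (h $$ j) * fls_X_intpow j) $$ n
      = (\<Sum>j | h $$ j \<noteq> 0. if j = n then h $$ j else 0)"
    unfolding fls_nth_sum by (rule sum.cong) auto
  also have "\<dots> = h $$ n"
    using fin by (simp add: sum.delta)
  finally show "h $$ n = (\<Sum>j | h $$ j \<noteq> 0. fls_const (h $$ j) * fls_X_intpow j) $$ n" ..
qed

lemma property_star_imp_eventual_polynomial:
  assumes "property_star a"
  shows "eventual_polynomial a (Phi a)"
proof -
  obtain d h where h: "laurent_polynomial h" and a: "a = h / (1 - fls_X) ^ d"
    using assms by (auto simp: property_star_def)
  define g :: "complex fls" where "g = inverse ((1 - fls_X) ^ d)"
  obtain p where p: "eventual_polynomial g p"
    using ex_eventual_polynomial_inverse g_def by blast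
  have "a = h * g" by (simp add: a g_def field_class.field_divide_inverse)
  also have "\<dots> = (\<Sum>j | h $$ j \<noteq> 0. fls_const (h $$ j) * fls_shift (- j) g)"
    unfolding arg_cong[OF laurent_polynomial_conv_sum[OF h], of "\<lambda>x. x * g"] sum_distrib_right
    by (rule sum.cong) (simp_all only: mult.assoc fls_X_intpow_times_conv_shift(1))
  finally have "\<exists>p. eventual_polynomial a p"
    using h eventual_polynomial_const_mult[OF eventual_polynomial_shift[OF p]]
    by (simp only: laurent_polynomial_def) (rule eventual_polynomial_sum, blast+)
  then show ?thesis using Phi_eqI by blast
qed

lemma eventual_polynomial_times_one_minus_X_power:
  assumes "eventual_polynomial f p" "p = 0 \<or> degree p < d"
  shows "laurent_polynomial (f * (1 - fls_X) ^ d)"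
  using assms
proof (induction d arbitrary: f p)
  case 0
  then show ?case by (simp add: eventual_polynomial_0_iff)
next
  case (Suc d)
  define q where "q = p + smult (-1) (pcompose p [:of_int (-1), 1:])"
  have "f * (1 - fls_X) = f + fls_const (-1) * fls_shift (-1) f"
    by (rule fls_eqI) (simp add: algebra_simps fls_X_times_conv_shift)
  then have "eventual_polynomial (f * (1 - fls_X)) q"
    using Suc.prems(1)
    by (simp only: q_def)
       (intro eventual_polynomial_add eventual_polynomial_const_mult eventual_polynomial_shift)
  moreover have "q = 0 \<or> degree q < d"
  proof (cases "degree p = 0")
    case True
    then obtain c where "p = [:c:]" by (metis degree_eq_zeroE)
    then show ?thesis by (simp add: q_def)
  next
    case False
    have deg: "degree (pcompose p [:-1, 1:]) = degree p"
      by (simp add: degree_pcompose)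
    moreover have "coeff (pcompose p [:-1, 1:]) (degree p) = coeff p (degree p)"
      using lead_coeff_comp[of "[:-1, 1:]" p] deg by simp
    ultimately have "degree q < degree p"
      using False unfolding q_def
      by (intro degree_lessI) (auto simp: coeff_eq_0 le_less)
    with Suc.prems(2) False show ?thesis by auto
  qed
  ultimately have "laurent_polynomial ((f * (1 - fls_X)) * (1 - fls_X) ^ d)"
    by (rule Suc.IH)
  then show ?case by (simp add: mult.assoc)
qed

lemma property_star_numerator:
  assumes "property_star a"
  shows "laurent_polynomial (h_of a)" "a = h_of a / (1 - fls_X) ^ d_of a"
proof -
  show "laurent_polynomial (h_of a)"
    unfolding h_of_def
    by (rule eventual_polynomial_times_one_minus_X_power
          [OF property_star_imp_eventual_polynomial[OF assms]])
       (simp add: d_of_def)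
qed (rule h_of_eq)

end

theory Submission
  imports Defs
begin

text \<open>When \<open>d_of a = 0\<close>, \<open>a\<close> is its own numerator, a Laurent
  polynomial. The support of \<open>segre a b\<close> lies in that of \<open>a\<close>, so
  \<open>segre a b\<close> is again a Laurent polynomial and its own numerator. This gives the
  degree bound, and the formula reduces to expanding \<open>b\<close> as its numerator times a power
  of 1/(1 - t) (\<open>nth_eq_sum_h_of\<close>). If the numerator of \<open>b\<close> is nonnegative
  and \<open>d_of b > 0\<close>, nothing cancels in that expansion, so \<open>b\<close> has no zero
  coefficient from \<open>sigma_of b\<close> on (\<open>nth_neq_0_of_h_of_nonneg\<close>); in
  particular the top coefficient of \<open>a\<close> survives.\<close>

lemma inverse_one_minus_fls_X_power_nth:
  assumes "m \<ge> 0"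
  shows "inverse ((1 - fls_X :: complex fls) ^ d) $$ m = of_int (int d - 1 + m) gchoose nat m"
proof (cases d)
  case 0
  \<comment> \<open>The series is 1 and the upper index is \<open>m - 1\<close>: the binomial is 1
    for \<open>m = 0\<close> despite the upper index -1, and vanishes for \<open>m > 0\<close>
    because then 0 \<le> \<open>m - 1\<close> < \<open>m\<close>.\<close>
  show ?thesis
  proof (cases "nat m")
    case (Suc i)
    then have "int d - 1 + m = int i"
      using \<open>d = 0\<close> by linarith
    then have "(of_int (int d - 1 + m) :: complex) = of_nat i"
      by (simp only: of_int_of_nat_eq)
    moreover have "m \<noteq> 0"
      using Suc by auto
    ultimately show ?thesis
      using \<open>d = 0\<close> binomial_gbinomial[of i "Suc i", where 'a = complex]
      by (simp add: Suc binomial_eq_0)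
  qed (use 0 assms in simp)
next
  case (Suc k)
  have "inverse ((1 - fls_X :: complex fls) ^ d) $$ m = of_nat ((nat m + k) choose k)"
    using assms unfolding Suc inverse_one_minus_fls_X_power by simp
  \<comment> \<open>The lower index \<open>k\<close> is \<open>d - 1\<close>; by symmetry it becomes
    \<open>nat m\<close>, which also makes sense for \<open>d = 0\<close>.\<close>
  also have "(nat m + k) choose k = (nat m + k) choose nat m"
    using binomial_symmetric[of k "nat m + k"] by simp
  also have "of_nat \<dots> = (of_nat (nat m + k) :: complex) gchoose nat m"
    by (rule binomial_gbinomial)
  also have "of_nat (nat m + k) = (of_int (int d - 1 + m) :: complex)"
    using assms Suc by simp
  finally show ?thesis .
qed

text \<open>Cauchy product of the numerator with the binomial series; both factors are bounded
  below, so the sum is finite.\<close>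

lemma nth_eq_sum_h_of:
  "a $$ n = (\<Sum>j = sigma_of a..n. h_of a $$ j * (of_int (b_of a + n - j) gchoose nat (n - j)))"
proof -
  define g where "g = inverse ((1 - fls_X :: complex fls) ^ d_of a)"
  \<comment> \<open>The inverse power starts at exponent 0, which makes \<open>n\<close> the upper
    limit of the convolution.\<close>
  have "fls_subdegree (1 - fls_X :: complex fls) = 0"
    by (rule fls_subdegree_eqI) auto
  then have sd: "fls_subdegree g = 0"
    by (simp add: g_def fls_subdegree_pow)
  have "a = h_of a * g"
    by (subst h_of_eq) (simp only: g_def field_class.field_divide_inverse)
  then have "a $$ n = (h_of a * g) $$ n" by simp
  also have "\<dots> = (\<Sum>j = sigma_of a..n. h_of a $$ j * g $$ (n - j))"
    by (simp add: fls_times_nth(1) sd sigma_of_def)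
  also have "\<dots> = (\<Sum>j = sigma_of a..n. h_of a $$ j * (of_int (b_of a + n - j) gchoose nat (n - j)))"
    by (rule sum.cong) (simp_all add: g_def inverse_one_minus_fls_X_power_nth b_of_def algebra_simps)
  finally show ?thesis .
qed

text \<open>No term of the expansion is negative, and the one at \<open>sigma_of b\<close> is
  positive: \<open>d_of b > 0\<close> keeps the upper index of each binomial at or above the lower
  one.\<close>

lemma nth_neq_0_of_h_of_nonneg:
  assumes "d_of b > 0" and nonneg: "\<And>j. h_of b $$ j \<in> \<real>\<^sub>\<ge>\<^sub>0"
    and "b \<noteq> 0" and "n \<ge> sigma_of b"
  shows "b $$ n \<noteq> 0"
proof -
  define c where "c j = nat (b_of b + n - j) choose nat (n - j)" for j
  have bc: "(of_int (b_of b + n - j) :: complex) gchoose nat (n - j) = of_nat (c j)"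
    if "j \<le> n" for j
    using that assms(1) by (simp add: c_def b_of_def binomial_gbinomial)
  have "b $$ n = (\<Sum>j = sigma_of b..n. h_of b $$ j * of_nat (c j))"
    unfolding nth_eq_sum_h_of[of b n] by (rule sum.cong) (simp_all only: bc atLeastAtMost_iff)
  \<comment> \<open>Real parts move the positivity argument into an ordered field.\<close>
  then have "Re (b $$ n) = (\<Sum>j = sigma_of b..n. Re (h_of b $$ j) * real (c j))"
    by simp
  also have "\<dots> > 0"
  proof (rule sum_pos2)
    have "h_of b \<noteq> 0"
      using \<open>b \<noteq> 0\<close> one_minus_fls_X_neq_0 by (simp add: h_of_def)
    then have "h_of b $$ sigma_of b \<noteq> 0"
      by (simp add: sigma_of_def)
    then have "Re (h_of b $$ sigma_of b) > 0"
      using nonneg[of "sigma_of b"] by (auto simp: complex_nonneg_Reals_iff complex_eq_iff)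
    moreover have "c (sigma_of b) > 0"
      using assms(1,4) by (simp add: c_def b_of_def)
    ultimately show "0 < Re (h_of b $$ sigma_of b) * real (c (sigma_of b))"
      by simp
    show "0 \<le> Re (h_of b $$ j) * real (c j)" for j
      using nonneg[of j] by (simp add: complex_nonneg_Reals_iff)
  qed (use assms(4) in auto)
  finally show ?thesis by auto
qed

lemma h_of_laurent_polynomial:
  assumes "laurent_polynomial f"
  shows "h_of f = f"
proof -
  have "Phi f = 0"
    using assms by (intro Phi_eqI) (simp add: eventual_polynomial_0_iff)
  then show ?thesis by (simp add: h_of_def d_of_def)
qed

theorem theorem2p2:
  fixes a b :: "complex fls"
  assumes "property_star a" and "property_star b"
    and "segre a b \<noteq> 0"
    and "d_of a = 0"
  shows "(\<forall>n::int.
            h_of (segre a b) $$ n = a $$ n * b $$ n \<and>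
            a $$ n * b $$ n =
              h_of a $$ n *
                (\<Sum>j = sigma_of b..n. h_of b $$ j * (of_int (b_of b + n - j) gchoose nat (n - j)))) \<and>
         laurent_degree (h_of (segre a b)) \<le> laurent_degree a \<and>
         (d_of b > 0 \<longrightarrow> (\<forall>j. h_of b $$ j \<in> \<real>\<^sub>\<ge>\<^sub>0) \<longrightarrow>
            laurent_degree (h_of (segre a b)) = laurent_degree a)"
proof -
  let ?A = "{n. a $$ n \<noteq> 0}" and ?S = "{n. segre a b $$ n \<noteq> 0}"
  have ha: "h_of a = a"
    using assms(4) by (simp add: h_of_def)
  then have finA: "finite ?A"
    using property_star_numerator(1)[OF assms(1)] by (simp add: laurent_polynomial_def)
  have sub: "?S \<subseteq> ?A" by auto
  then have finS: "finite ?S"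
    using finA by (rule finite_subset)
  then have hs: "h_of (segre a b) = segre a b"
    by (intro h_of_laurent_polynomial) (simp only: laurent_polynomial_def)
  \<comment> \<open>This exponent makes both supports nonempty, so that \<open>Max\<close> is
    meaningful, and it links \<open>sigma_of b\<close> to the degree of \<open>a\<close>
    below.\<close>
  obtain m where m: "segre a b $$ m \<noteq> 0"
    using assms(3) by (auto simp: fls_eq_iff)
  have le: "laurent_degree (segre a b) \<le> laurent_degree a"
    unfolding laurent_degree_def using m by (intro Max_mono sub finA) auto
  have "laurent_degree a \<le> laurent_degree (segre a b)"
    if "d_of b > 0" "\<forall>j. h_of b $$ j \<in> \<real>\<^sub>\<ge>\<^sub>0"
  proof -
    have D: "a $$ laurent_degree a \<noteq> 0"
      using Max_in[OF finA] m by (auto simp: laurent_degree_def)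
    have "b \<noteq> 0" and "sigma_of b \<le> m" and "m \<le> laurent_degree a"
      using m Max_ge[OF finA, of m]
      by (auto simp: sigma_of_eq laurent_degree_def intro: fls_subdegree_leI)
    then have "b $$ laurent_degree a \<noteq> 0"
      using that by (intro nth_neq_0_of_h_of_nonneg) auto
    with D have "laurent_degree a \<in> ?S" by simp
    then show ?thesis
      unfolding laurent_degree_def[of "segre a b"] by (rule Max_ge[OF finS])
  qed
  with le show ?thesis
    \<comment> \<open>Read backwards, the expansion collapses the binomial sum to
      \<open>b $$ n\<close>.\<close>
    unfolding hs ha nth_eq_sum_h_of[of b, symmetric] by auto
qed

end
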